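(* Let $p\in(1,\infty)$, $\theta\in(0,\infty)$, $\sigma>1+\theta$, $0\le m<1+\theta$, $\alpha>0$, $\mathfrak{B}\in C^0(\overline{B_1};\mathbb{R}^n)$, $\varrho\in C^0(\overline{B_1})$. Let $\mathrm{F}\Subset B_1$ be a closed set and let $\mathfrak{f}:B_1\to\mathbb{R}_+$ be a continuous function for which there are constants $0<c_1\le c_2$ with $c_1\,\mathrm{dist}(x,\mathrm{F})^\alpha\le\mathfrak{f}(x)\le c_2\,\mathrm{dist}(x,\mathrm{F})^\alpha$ for $x\in B_1$. Let $u\in C^0(B_1)$ be a non-negative viscosity solution of $$|\nabla u|^{\theta}\Delta_p^{\mathrm N}u+\langle\mathfrak{B}(x),\nabla u\rangle|\nabla u|^\theta+\varrho(x)|\nabla u|^\sigma=\mathfrak{f}(x)u_+^m(x)\quad\text{in }B_1,$$ and let $x_0\in\overline{\{u>0\}}\cap B_{1/2}$. Suppose further that $\mathfrak{f}(x)\ge\mathfrak{c}_0|x|^\alpha$ in $B_1$ for a constant $\mathfrak{c}_0>0$. Then there exists a constant $C_{\rm ND}>0$, depending only on $n$, $p$, $\theta$, $\sigma$, $\mathfrak{c}_0$, $\|\mathfrak{B}\|_{L^\infty(B_1;\mathbb{R}^n)}$ and $\|\varrho\|_{L^\infty(B_1)}$, such that for all $r\in(0,1/2)$ $$\sup_{\partial B_r(x_0)}u\ge C_{\rm ND}\,r^{\frac{2+\theta+\alpha}{1+\theta-m}}.$$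
   Context: $B_r(x_0)$ is the open ball of radius $r$ centered at $x_0\in\mathbb{R}^n$, and $B_r=B_r(0)$; $u_+=\max\{u,0\}$. The normalized $p$-Laplacian is $\Delta_p^{\mathrm N}u=\Delta u+(p-2)\left\langle D^2u\frac{\nabla u}{|\nabla u|},\frac{\nabla u}{|\nabla u|}\right\rangle$. Write $H(\xi,x)=\langle\mathfrak{B}(x),\xi\rangle|\xi|^\theta+\varrho(x)|\xi|^\sigma$. For a symmetric matrix $X$, $\lambda_{\max}(X)$ and $\lambda_{\min}(X)$ denote its largest and smallest eigenvalues. Viscosity solutions: put $f_0(x,s)=\mathfrak{f}(x)s_+^m$. A continuous function $u$ is a viscosity subsolution (respectively supersolution) of $|\nabla u|^\theta\Delta_p^{\mathrm N}u+H(\nabla u,x)=f_0(x,u)$ in $\Omega$ if, whenever $\phi\in C^2(\Omega)$ and $u-\phi$ has a local maximum (respectively minimum) at $x_0\in\Omega$ with $\phi(x_0)=u(x_0)$: (1) if $\nabla\phi(x_0)\neq0$, then $|\nabla\phi(x_0)|^\theta\Delta_p^{\mathrm N}\phi(x_0)+H(\nabla\phi(x_0),x_0)\ge f_0(x_0,\phi(x_0))$ (respectively $\le$); (2) if $\nabla\phi(x_0)=0$ and $p\ge2$, then $\Delta\phi(x_0)+(p-2)\lambda_{\max}(D^2\phi(x_0))\ge f_0(x_0,\phi(x_0))$ (respectively $\Delta\phi(x_0)+(p-2)\lambda_{\min}(D^2\phi(x_0))\le f_0(x_0,\phi(x_0))$); (3) if $\nabla\phi(x_0)=0$ and $1<p<2$,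 then $\Delta\phi(x_0)+(p-2)\lambda_{\min}(D^2\phi(x_0))\ge f_0(x_0,\phi(x_0))$ (respectively $\Delta\phi(x_0)+(p-2)\lambda_{\max}(D^2\phi(x_0))\le f_0(x_0,\phi(x_0))$). A viscosity solution is both a viscosity subsolution and a viscosity supersolution.
   Formalization: The constant C_ND is also allowed to depend on m and α; independence of them is false, as u = A|x|^β with f = c_0|x|^α, F = {0}, x_0 = 0 shows, where A → 0 as m → 1+θ or α → ∞. *)

theory Defs
  imports "HOL-Analysis.Analysis" "HOL-Probability.Essential_Supremum"
begin

definition compactly_contained :: "'a::topological_space set \<Rightarrow> 'a set \<Rightarrow> bool" where
  "compactly_contained A U \<longleftrightarrow> compact (closure A) \<and> closure A \<subseteq> U"

definition Linf_norm :: "'a::euclidean_space set \<Rightarrow> ('a \<Rightarrow> 'b::real_normed_vector) \<Rightarrow> ereal" where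
  "Linf_norm S g = esssup (lebesgue_on S) (\<lambda>x. ereal (norm (g x)))"

definition grad :: "(real^'n \<Rightarrow> real) \<Rightarrow> real^'n \<Rightarrow> real^'n" where
  "grad \<phi> x = (THE D. GDERIV \<phi> x :> D)"

definition hess :: "(real^'n \<Rightarrow> real) \<Rightarrow> real^'n \<Rightarrow> real^'n^'n" where
  "hess \<phi> x = jacobian (grad \<phi>) (at x)"

text \<open>For open sets: the gradient exists, is itself differentiable (hence continuous),
  and the Hessian is continuous.\<close>

definition C2_on :: "(real^'n) set \<Rightarrow> (real^'n \<Rightarrow> real) \<Rightarrow> bool" where
  "C2_on \<Omega> \<phi> \<longleftrightarrow>
     (\<forall>x\<in>\<Omega>. \<phi> differentiable (at x)) \<and>
     (\<forall>x\<in>\<Omega>. grad \<phi> differentiable (at x)) \<and>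
     continuous_on \<Omega> (hess \<phi>)"

definition laplacian :: "(real^'n \<Rightarrow> real) \<Rightarrow> real^'n \<Rightarrow> real" where
  "laplacian \<phi> x = trace (hess \<phi> x)"

definition normalized_p_laplacian :: "real \<Rightarrow> (real^'n \<Rightarrow> real) \<Rightarrow> real^'n \<Rightarrow> real" where
  "normalized_p_laplacian p \<phi> x =
     (let e = grad \<phi> x /\<^sub>R norm (grad \<phi> x)
      in laplacian \<phi> x + (p - 2) * ((hess \<phi> x *v e) \<bullet> e))"

definition eigenvalues :: "real^'n^'n \<Rightarrow> real set" where
  "eigenvalues X = {l. \<exists>v. v \<noteq> 0 \<and> X *v v = l *\<^sub>R v}"

definition lambda_max :: "real^'n^'n \<Rightarrow> real" where
  "lambda_max X = Max (eigenvalues X)"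

definition lambda_min :: "real^'n^'n \<Rightarrow> real" where
  "lambda_min X = Min (eigenvalues X)"

definition H_term :: "real \<Rightarrow> real \<Rightarrow> (real^'n \<Rightarrow> real^'n) \<Rightarrow> (real^'n \<Rightarrow> real)
    \<Rightarrow> real^'n \<Rightarrow> real^'n \<Rightarrow> real" where
  "H_term \<theta> \<sigma> B \<rho> \<xi> x = (B x \<bullet> \<xi>) * norm \<xi> powr \<theta> + \<rho> x * norm \<xi> powr \<sigma>"

text \<open>Since \<open>0 powr 0 = 0\<close>, for \<open>m = 0\<close> the factor below is the indicator of \<open>s > 0\<close>.\<close>

definition f0_term :: "real \<Rightarrow> (real^'n \<Rightarrow> real) \<Rightarrow> real^'n \<Rightarrow> real \<Rightarrow> real" where
  "f0_term m f x s = f x * (max s 0) powr m"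

definition local_max_at :: "(real^'n) set \<Rightarrow> (real^'n \<Rightarrow> real) \<Rightarrow> real^'n \<Rightarrow> bool" where
  "local_max_at \<Omega> g x0 \<longleftrightarrow> (\<exists>e>0. \<forall>y\<in>\<Omega> \<inter> ball x0 e. g y \<le> g x0)"

definition local_min_at :: "(real^'n) set \<Rightarrow> (real^'n \<Rightarrow> real) \<Rightarrow> real^'n \<Rightarrow> bool" where
  "local_min_at \<Omega> g x0 \<longleftrightarrow> (\<exists>e>0. \<forall>y\<in>\<Omega> \<inter> ball x0 e. g x0 \<le> g y)"

text \<open>Viscosity sub- and supersolutions of
  \<open>|\<nabla>u|\<^sup>\<theta> \<Delta>\<^sub>p\<^sup>N u + H(\<nabla>u, x) = f\<^sub>0(x, u)\<close> in the open set \<open>\<Omega>\<close>.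
  At critical points of the test function the factor \<open>|\<nabla>\<phi>|\<^sup>\<theta>\<close> is dropped on purpose.\<close>

definition viscosity_subsolution :: "real \<Rightarrow> real \<Rightarrow> (real^'n \<Rightarrow> real^'n \<Rightarrow> real)
    \<Rightarrow> (real^'n \<Rightarrow> real \<Rightarrow> real) \<Rightarrow> (real^'n) set \<Rightarrow> (real^'n \<Rightarrow> real) \<Rightarrow> bool" where
  "viscosity_subsolution p \<theta> H f0 \<Omega> u \<longleftrightarrow>
     continuous_on \<Omega> u \<and>
     (\<forall>\<phi> x0. C2_on \<Omega> \<phi> \<and> x0 \<in> \<Omega> \<and> local_max_at \<Omega> (\<lambda>y. u y - \<phi> y) x0 \<and> \<phi> x0 = u x0 \<longrightarrow>
        (grad \<phi> x0 \<noteq> 0 \<longrightarrow>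
           norm (grad \<phi> x0) powr \<theta> * normalized_p_laplacian p \<phi> x0 + H (grad \<phi> x0) x0
             \<ge> f0 x0 (\<phi> x0)) \<and>
        (grad \<phi> x0 = 0 \<and> p \<ge> 2 \<longrightarrow>
           laplacian \<phi> x0 + (p - 2) * lambda_max (hess \<phi> x0) \<ge> f0 x0 (\<phi> x0)) \<and>
        (grad \<phi> x0 = 0 \<and> 1 < p \<and> p < 2 \<longrightarrow>
           laplacian \<phi> x0 + (p - 2) * lambda_min (hess \<phi> x0) \<ge> f0 x0 (\<phi> x0)))"

definition viscosity_supersolution :: "real \<Rightarrow> real \<Rightarrow> (real^'n \<Rightarrow> real^'n \<Rightarrow> real)
    \<Rightarrow> (real^'n \<Rightarrow> real \<Rightarrow> real) \<Rightarrow> (real^'n) set \<Rightarrow> (real^'n \<Rightarrow> real) \<Rightarrow> bool" where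
  "viscosity_supersolution p \<theta> H f0 \<Omega> u \<longleftrightarrow>
     continuous_on \<Omega> u \<and>
     (\<forall>\<phi> x0. C2_on \<Omega> \<phi> \<and> x0 \<in> \<Omega> \<and> local_min_at \<Omega> (\<lambda>y. u y - \<phi> y) x0 \<and> \<phi> x0 = u x0 \<longrightarrow>
        (grad \<phi> x0 \<noteq> 0 \<longrightarrow>
           norm (grad \<phi> x0) powr \<theta> * normalized_p_laplacian p \<phi> x0 + H (grad \<phi> x0) x0
             \<le> f0 x0 (\<phi> x0)) \<and>
        (grad \<phi> x0 = 0 \<and> p \<ge> 2 \<longrightarrow>
           laplacian \<phi> x0 + (p - 2) * lambda_min (hess \<phi> x0) \<le> f0 x0 (\<phi> x0)) \<and>
        (grad \<phi> x0 = 0 \<and> 1 < p \<and> p < 2 \<longrightarrow>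
           laplacian \<phi> x0 + (p - 2) * lambda_max (hess \<phi> x0) \<le> f0 x0 (\<phi> x0)))"

definition viscosity_solution :: "real \<Rightarrow> real \<Rightarrow> (real^'n \<Rightarrow> real^'n \<Rightarrow> real)
    \<Rightarrow> (real^'n \<Rightarrow> real \<Rightarrow> real) \<Rightarrow> (real^'n) set \<Rightarrow> (real^'n \<Rightarrow> real) \<Rightarrow> bool" where
  "viscosity_solution p \<theta> H f0 \<Omega> u \<longleftrightarrow>
     viscosity_subsolution p \<theta> H f0 \<Omega> u \<and> viscosity_supersolution p \<theta> H f0 \<Omega> u"

end

theory Submission
  imports Defs
begin

text \<open>
  Only the subsolution property is used, and it is only tested against quadratics
  \<open>c + A |x - w|\<^sup>2\<close>, for which the operator is explicit. With \<open>K = n + p - 2 > 0\<close> and away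
  from the vertex, the normalized \<open>p\<close>-Laplacian is \<open>2AK\<close>; the gradient has norm
  \<open>2|A||x - w|\<close>, and as long as this is at most \<open>1\<close>, the condition \<open>\<sigma> > 1 + \<theta>\<close> lets the
  first-order term be bounded by a multiple of its \<open>(1 + \<theta>)\<close>-th power.

  \<^item> \<^emph>\<open>Maximum principle\<close> (\<open>maximum_principle\<close>): over a ball, \<open>u\<close> is dominated by its values
    on the sphere. Testing with a constant excludes positive local maxima except at the
    origin, the only point where \<open>f\<close> may vanish; there, a flat concave quadratic with vertex
    close to but different from \<open>0\<close> does.

  \<^item> \<^emph>\<open>Growth\<close> (\<open>growth\<close>): where \<open>f \<ge> \<kappa>\<close>, the value \<open>u y\<close> is exceeded by \<open>A r\<^sup>2\<close> somewhere on
    the sphere of radius \<open>r\<close> around \<open>y\<close>, provided \<open>A |x - w|\<^sup>2\<close> is a strict supersolution away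
    from its vertex. Otherwise, for each \<open>w\<close> near \<open>y\<close>, the function \<open>u - A |x - w|\<^sup>2\<close> attains
    an interior maximum, which can only lie at the vertex \<open>w\<close>, where the gradient vanishes
    and the supersolution property is lost. Then \<open>u x \<le> u w + A |x - w|\<^sup>2\<close> for all \<open>x\<close>, \<open>w\<close>
    near \<open>y\<close>, so \<open>u\<close> has zero derivative and is constant there, which the constant test
    forbids. Moving the vertex thus replaces the barrier with power
    \<open>(2 + \<theta>) / (1 + \<theta>)\<close>, which is not twice differentiable.

  \<^item> \<^emph>\<open>Doubling\<close> (\<open>doubling\<close>): let \<open>\<beta> = (2 + \<theta> + \<alpha>) / (1 + \<theta> - m)\<close>. If \<open>u\<close> reaches
    \<open>c t\<^sup>\<beta>\<close> in the ball of radius \<open>t\<close> around \<open>a\<close>, it reaches \<open>c (2t)\<^sup>\<beta>\<close> in the ball of radius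
    \<open>2t\<close>: by the maximum principle the first value is reached at a point at distance at
    least \<open>t/4\<close> from the origin, and around it \<open>f \<ge> c0 (t/8)\<^sup>\<alpha>\<close>, so that the growth lemma
    applies. Since \<open>m < 1 + \<theta>\<close>, a small \<open>c\<close> works, uniformly in \<open>t\<close>.

  Around a point \<open>a\<close> with \<open>u a > 0\<close> the bound \<open>c t\<^sup>\<beta>\<close> holds trivially for tiny \<open>t\<close>, so doubling
  carries it to every radius. For \<open>x0\<close> in the closure of the positivity set, this is applied
  at a positivity point close to \<open>x0\<close>, and the maximum principle moves the large value to the
  sphere. It does not matter where \<open>x0\<close> lies relative to the origin.
\<close>

section \<open>Quadratic test functions\<close>

lemma grad_eqI: "GDERIV \<phi> x :> D \<Longrightarrow> grad \<phi> x = D"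
  unfolding grad_def
proof (rule the_equality)
  fix E assume "GDERIV \<phi> x :> D" "GDERIV \<phi> x :> E"
  then have "(\<lambda>h. h \<bullet> E) = (\<lambda>h. h \<bullet> D)"
    unfolding gderiv_def by (rule has_derivative_unique[rotated])
  then have "(E - D) \<bullet> (E - D) = 0"
    by (metis inner_diff_right right_minus_eq)
  then show "E = D" by simp
qed auto

lemma grad_quadratic:
  "grad (\<lambda>x. c + A * (dist x w)\<^sup>2) = (\<lambda>x :: real^'n. (2 * A) *\<^sub>R (x - w))"
proof
  fix x :: "real^'n"
  have "((\<lambda>x. c + A * ((x - w) \<bullet> (x - w))) has_derivative (\<lambda>h. h \<bullet> (2 * A) *\<^sub>R (x - w))) (at x)"
    by (auto intro!: derivative_eq_intros simp: inner_commute algebra_simps)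
  then show "grad (\<lambda>x. c + A * (dist x w)\<^sup>2) x = (2 * A) *\<^sub>R (x - w)"
    by (intro grad_eqI) (simp add: gderiv_def dist_norm power2_norm_eq_inner)
qed

lemma hess_quadratic:
  "hess (\<lambda>x. c + A * (dist x w)\<^sup>2) = (\<lambda>x :: real^'n. mat (2 * A))"
proof
  fix x :: "real^'n"
  have "((\<lambda>x. (2 * A) *\<^sub>R (x - w)) has_derivative (\<lambda>h. (2 * A) *\<^sub>R h)) (at x)"
    by (auto intro!: derivative_eq_intros)
  then have "frechet_derivative (\<lambda>x. (2 * A) *\<^sub>R (x - w)) (at x) = (\<lambda>h. (2 * A) *\<^sub>R h)"
    by (rule frechet_derivative_at[symmetric])
  then show "hess (\<lambda>x. c + A * (dist x w)\<^sup>2) x = mat (2 * A)"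
    unfolding hess_def grad_quadratic jacobian_def
    by (simp add: matrix_def mat_def vec_eq_iff axis_def)
qed

lemma C2_on_quadratic: "C2_on \<Omega> (\<lambda>x :: real^'n. c + A * (dist x w)\<^sup>2)"
proof -
  have "(\<lambda>x. c + A * ((x - w) \<bullet> (x - w))) differentiable (at x)" for x :: "real^'n"
    unfolding differentiable_def by (rule exI, auto intro!: derivative_eq_intros)
  then show ?thesis
    unfolding C2_on_def grad_quadratic hess_quadratic
    by (auto simp: dist_norm power2_norm_eq_inner intro!: derivative_intros)
qed

lemma mat_mult_vec: "mat a *v x = a *\<^sub>R (x :: real^'n)"
proof -
  have "(\<Sum>j\<in>UNIV. (if i = j then a else 0) * x $ j) = (\<Sum>j\<in>UNIV. if i = j then a * x $ j else 0)" for i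
    by (intro sum.cong) auto
  then show ?thesis by (simp add: mat_def matrix_vector_mult_def vec_eq_iff)
qed

lemma eigenvalues_mat: "eigenvalues (mat a :: real^'n^'n) = {a}"
proof -
  obtain v :: "real^'n" where "v \<noteq> 0" using nonempty_Basis nonzero_Basis by blast
  then show ?thesis by (auto simp: eigenvalues_def mat_mult_vec)
qed

lemma trace_mat: "trace (mat a :: real^'n^'n) = real CARD('n) * a"
  by (simp add: trace_def mat_def)

lemma normalized_p_laplacian_quadratic:
  assumes "A \<noteq> 0" "x \<noteq> w"
  shows "normalized_p_laplacian p (\<lambda>x :: real^'n. c + A * (dist x w)\<^sup>2) x = 2 * A * (real CARD('n) + p - 2)"
proof -
  define e where "e = ((2 * A) *\<^sub>R (x - w)) /\<^sub>R norm ((2 * A) *\<^sub>R (x - w))"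
  have "norm e = 1" 
    unfolding e_def sgn_div_norm[symmetric] norm_sgn using assms by simp
  then have "e \<bullet> e = 1" by (simp add: norm_eq_1)
  then show ?thesis
    unfolding normalized_p_laplacian_def laplacian_def grad_quadratic hess_quadratic Let_def e_def[symmetric]
    by (simp add: mat_mult_vec trace_mat algebra_simps)
qed

section \<open>Two facts about continuous functions\<close>

lemma continuous_Linf_norm_bound:
  fixes g :: "'a::euclidean_space \<Rightarrow> 'b::real_normed_vector"
  assumes "open S" "continuous_on S g" "Linf_norm S g = ereal b" "x \<in> S"
  shows "norm (g x) \<le> b"
proof (rule ccontr)
  assume "\<not> norm (g x) \<le> b"
  define N where "N = {y \<in> S. norm (g y) > b}"
  have "N = S \<inter> (\<lambda>y. norm (g y)) -` {b<..}" by (auto simp: N_def)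
  then have op: "open N"
    using continuous_open_preimage[OF continuous_on_norm[OF assms(2)] assms(1), of "{b<..}"] by auto
  have "emeasure (lebesgue_on S) N = 0"
    using esssup_zero_measure[of "lebesgue_on S" "\<lambda>x. ereal (norm (g x))"] assms(3)
    by (simp add: Linf_norm_def N_def space_restrict_space)
  moreover have "N \<in> sets lebesgue" "S \<in> sets lebesgue"
    using op assms(1) by (simp_all add: lborelD)
  moreover have "N \<subseteq> S" by (auto simp: N_def)
  ultimately have "negligible N"
    by (simp add: emeasure_restrict_space negligible_iff_emeasure0)
  then have "N = {}" using op open_not_negligible by blast
  then show False using \<open>\<not> norm (g x) \<le> b\<close> assms(4) by (auto simp: N_def)
qed

text \<open>Exchanging \<open>x\<close> and \<open>w\<close> turns the one-sided bound into a two-sided one, so every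
  derivative of \<open>u\<close> on \<open>S\<close> is zero.\<close>

lemma constant_if_quadratic_upper_bound:
  fixes u :: "'a::real_normed_vector \<Rightarrow> real"
  assumes "open S" "connected S" and bound: "\<And>x w. x \<in> S \<Longrightarrow> w \<in> S \<Longrightarrow> u x \<le> u w + A * (dist x w)\<^sup>2"
    and "x \<in> S" "y \<in> S"
  shows "u x = u y"
proof (rule has_derivative_zero_unique_connected[OF assms(1,2) _ assms(4,5)])
  fix w assume w: "w \<in> S"
  have *: "\<bar>u x - u w\<bar> \<le> A * (dist x w)\<^sup>2" if "x \<in> S" for x
    using bound[OF that w] bound[OF w that] by (simp add: dist_commute)
  have "((\<lambda>x. A * norm (x - w)) \<longlongrightarrow> A * norm (w - w)) (at w)"
    by (intro tendsto_intros)
  then have lim: "((\<lambda>x. A * norm (x - w)) \<longlongrightarrow> 0) (at w)" by simp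
  have "((\<lambda>x. norm (u x - u w - 0) / norm (x - w)) \<longlongrightarrow> 0) (at w)"
  proof (rule Lim_null_comparison[OF _ lim])
    show "\<forall>\<^sub>F x in at w. norm (norm (u x - u w - 0) / norm (x - w)) \<le> A * norm (x - w)"
      unfolding eventually_at_topological
    proof (intro exI[of _ S] conjI assms(1) w ballI impI)
      fix x assume "x \<in> S" "x \<noteq> w"
      then show "norm (norm (u x - u w - 0) / norm (x - w)) \<le> A * norm (x - w)"
        using *[of x] by (simp add: divide_le_eq dist_norm power2_eq_square mult.assoc)
    qed
  qed
  then show "(u has_derivative (\<lambda>x. 0)) (at w)"
    unfolding has_derivative_iff_norm by (intro conjI bounded_linear_zero)
qed

section \<open>Testing a nonnegative subsolution\<close>

text \<open>Nonnegative viscosity subsolutions in the unit ball whose lower-order coefficients are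
  bounded by \<open>b\<close> and \<open>q\<close>, with \<open>f\<close> bounded below by \<open>c0 |x|\<^sup>\<alpha>\<close>. The parameter \<open>K\<close> abbreviates
  \<open>n + p - 2\<close>, the normalized \<open>p\<close>-Laplacian of \<open>|x|\<^sup>2 / 2\<close> away from \<open>0\<close>.\<close>

locale nonnegative_subsolution =
  fixes p \<theta> \<sigma> m \<alpha> c0 b q K :: real
    and B :: "real^'n \<Rightarrow> real^'n" and \<rho> f u :: "real^'n \<Rightarrow> real"
  assumes p: "1 < p" and \<theta>: "0 < \<theta>" and \<sigma>: "1 + \<theta> < \<sigma>" and m: "0 \<le> m"
    and K_def: "K = real CARD('n) + p - 2"
    and \<alpha>: "0 < \<alpha>" and c0: "0 < c0"
    and B_bound: "\<And>x. x \<in> ball 0 1 \<Longrightarrow> norm (B x) \<le> b"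
    and \<rho>_bound: "\<And>x. x \<in> ball 0 1 \<Longrightarrow> \<bar>\<rho> x\<bar> \<le> q"
    and f_lower: "\<And>x. x \<in> ball 0 1 \<Longrightarrow> c0 * norm x powr \<alpha> \<le> f x"
    and u_nonneg: "\<And>x. x \<in> ball 0 1 \<Longrightarrow> 0 \<le> u x"
    and subsol: "viscosity_subsolution p \<theta> (H_term \<theta> \<sigma> B \<rho>) (f0_term m f) (ball 0 1) u"
begin

lemma K_pos: "K > 0"
proof -
  have "real CARD('n) \<ge> 1" by (simp add: Suc_leI)
  then show ?thesis using p unfolding K_def by linarith
qed

lemma b_nonneg: "0 \<le> b" using order_trans[OF norm_ge_zero B_bound[of 0]] by simp
lemma q_nonneg: "0 \<le> q" using \<rho>_bound[of 0] by simp

lemma u_cont: "continuous_on (ball 0 1) u"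
  using subsol by (simp add: viscosity_subsolution_def)

lemma f_nonneg: "x \<in> ball 0 1 \<Longrightarrow> 0 \<le> f x"
  using f_lower[of x] c0 by (smt (verit) mult_nonneg_nonneg powr_ge_zero)

lemma constant_test:
  assumes "z \<in> ball 0 1" "e > 0" "\<And>y. y \<in> ball 0 1 \<inter> ball z e \<Longrightarrow> u y \<le> u z"
  shows "f z * max (u z) 0 powr m \<le> 0"
proof -
  define \<phi> where "\<phi> = (\<lambda>x :: real^'n. u z + 0 * (dist x z)\<^sup>2)"
  have "local_max_at (ball 0 1) (\<lambda>y. u y - \<phi> y) z"
    using assms(2,3) unfolding local_max_at_def \<phi>_def by (intro exI[of _ e]) auto
  moreover have "C2_on (ball 0 1) \<phi>" unfolding \<phi>_def by (rule C2_on_quadratic)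
  moreover have "grad \<phi> z = 0" "hess \<phi> z = mat 0" "\<phi> z = u z"
    unfolding \<phi>_def grad_quadratic hess_quadratic by simp_all
  moreover from this have "lambda_max (hess \<phi> z) = 0" "lambda_min (hess \<phi> z) = 0" "laplacian \<phi> z = 0"
    by (simp_all only: lambda_max_def lambda_min_def eigenvalues_mat laplacian_def trace_mat) auto
  ultimately show ?thesis
    using subsol[unfolded viscosity_subsolution_def, THEN conjunct2, rule_format, of \<phi> z] assms(1) p
    by (cases "p \<ge> 2") (auto simp: f0_term_def)
qed

lemma H_term_le:
  assumes "x \<in> ball 0 1" "norm \<xi> \<le> 1"
  shows "H_term \<theta> \<sigma> B \<rho> \<xi> x \<le> norm \<xi> powr \<theta> * ((b + q) * norm \<xi>)"
proof -
  have "norm \<xi> powr \<sigma> \<le> norm \<xi> powr (1 + \<theta>)"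
    using \<sigma> assms(2) by (cases "\<xi> = 0") (auto intro!: powr_mono')
  also have "\<dots> = norm \<xi> * norm \<xi> powr \<theta>"
    by (cases "\<xi> = 0") (auto simp: powr_add)
  finally have 1: "norm \<xi> powr \<sigma> \<le> norm \<xi> * norm \<xi> powr \<theta>" .
  have "\<rho> x * norm \<xi> powr \<sigma> \<le> q * norm \<xi> powr \<sigma>"
    using \<rho>_bound[OF assms(1)] by (intro mult_right_mono) auto
  also have "\<dots> \<le> q * (norm \<xi> * norm \<xi> powr \<theta>)"
    using 1 q_nonneg by (intro mult_left_mono)
  finally have 2: "\<rho> x * norm \<xi> powr \<sigma> \<le> q * (norm \<xi> * norm \<xi> powr \<theta>)" .
  have "B x \<bullet> \<xi> \<le> norm (B x) * norm \<xi>" by (rule norm_cauchy_schwarz)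
  also have "\<dots> \<le> b * norm \<xi>" using B_bound[OF assms(1)] by (intro mult_right_mono) auto
  finally have "(B x \<bullet> \<xi>) * norm \<xi> powr \<theta> \<le> (b * norm \<xi>) * norm \<xi> powr \<theta>"
    by (intro mult_right_mono) auto
  with 2 show ?thesis unfolding H_term_def by (simp add: algebra_simps)
qed

lemma quadratic_test:
  assumes "z \<in> ball 0 1" "e > 0" "A \<noteq> 0" "z \<noteq> w"
    and max: "\<And>y. y \<in> ball 0 1 \<inter> ball z e \<Longrightarrow> u y - A * (dist y w)\<^sup>2 \<le> u z - A * (dist z w)\<^sup>2"
    and small: "2 * \<bar>A\<bar> * dist z w \<le> 1"
  shows "f z * max (u z) 0 powr m
           \<le> (2 * \<bar>A\<bar> * dist z w) powr \<theta> * (2 * A * K + (b + q) * (2 * \<bar>A\<bar> * dist z w))"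
proof -
  define \<phi> where "\<phi> = (\<lambda>x :: real^'n. (u z - A * (dist z w)\<^sup>2) + A * (dist x w)\<^sup>2)"
  have loc: "local_max_at (ball 0 1) (\<lambda>y. u y - \<phi> y) z"
    using assms(2) max unfolding local_max_at_def \<phi>_def by (intro exI[of _ e]) force
  have C2: "C2_on (ball 0 1) \<phi>" unfolding \<phi>_def by (rule C2_on_quadratic)
  have eq: "\<phi> z = u z" by (simp add: \<phi>_def)
  have g: "grad \<phi> z \<noteq> 0" "norm (grad \<phi> z) = 2 * \<bar>A\<bar> * dist z w"
    unfolding \<phi>_def grad_quadratic using assms(3,4) by (simp_all add: dist_norm abs_mult)
  have L: "normalized_p_laplacian p \<phi> z = 2 * A * K"
    unfolding \<phi>_def K_def by (rule normalized_p_laplacian_quadratic[OF assms(3,4)])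
  have "f z * max (u z) 0 powr m
      \<le> norm (grad \<phi> z) powr \<theta> * (2 * A * K) + H_term \<theta> \<sigma> B \<rho> (grad \<phi> z) z"
    using subsol[unfolded viscosity_subsolution_def, THEN conjunct2, rule_format, of \<phi> z]
      loc C2 eq g(1) assms(1) by (simp add: f0_term_def L)
  also have "\<dots> \<le> norm (grad \<phi> z) powr \<theta> * (2 * A * K)
                + norm (grad \<phi> z) powr \<theta> * ((b + q) * norm (grad \<phi> z))"
    using H_term_le[OF assms(1), of "grad \<phi> z"] g(2) small by simp
  finally show ?thesis unfolding g(2) by (simp add: distrib_left)
qed

section \<open>Maximum principle\<close>

lemma no_local_max:
  assumes "z \<in> ball 0 1" "z \<noteq> 0" "0 < u z" "e > 0"
    and "\<And>y. y \<in> ball 0 1 \<inter> ball z e \<Longrightarrow> u y \<le> u z"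
  shows False
proof -
  have "0 < c0 * norm z powr \<alpha>" using c0 assms(2) by simp
  also have "\<dots> \<le> f z" by (rule f_lower[OF assms(1)])
  finally have "0 < f z * max (u z) 0 powr m" using assms(3) by simp
  with constant_test[OF assms(1,4,5)] show False by simp
qed

text \<open>At the origin \<open>f\<close> may vanish, so the constant test is void. Here \<open>u\<close> is compared with
  \<open>- \<epsilon> |x - w|\<^sup>2\<close> on a ball not containing \<open>w\<close>: the gradient does not vanish, and on a ball small
  compared with \<open>K / (b + q)\<close> the second-order term, which is negative, outweighs \<open>H\<close>.\<close>

lemma no_strict_local_max:
  assumes "r > 0" "cball (0 :: real^'n) r \<subseteq> ball 0 1" and strict: "\<And>y. y \<in> cball 0 r - {0} \<Longrightarrow> u y < u 0"
  shows False
proof -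
  define s where "s = min r (K / (4 * (b + q + 1)))"
  have bq: "0 < b + q + 1" using b_nonneg q_nonneg by simp
  have s: "0 < s" "s \<le> r" using assms(1) K_pos bq by (auto simp: s_def)
  have "s * (4 * (b + q + 1)) \<le> K"
    using bq by (simp add: s_def min_def pos_le_divide_eq[symmetric])
  moreover have "3 * s * (b + q) < s * (4 * (b + q + 1))"
  proof -
    have "s * (4 * (b + q + 1)) = 3 * s * (b + q) + (s * (b + q) + 4 * s)"
      by (simp add: algebra_simps)
    moreover have "0 \<le> s * (b + q)" using s(1) b_nonneg q_nonneg by simp
    ultimately show ?thesis using s(1) by linarith
  qed
  ultimately have sK: "3 * s * (b + q) < K" by linarith
  have sub: "cball (0 :: real^'n) s \<subseteq> ball 0 1" using order_trans[OF subset_cball[OF s(2)] assms(2)] .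
  have ne: "sphere (0 :: real^'n) s \<noteq> {}" using s(1) by simp
  have cont: "continuous_on (cball 0 s) u" using u_cont sub by (rule continuous_on_subset)
  obtain z0 where z0: "z0 \<in> sphere 0 s" "\<And>y. y \<in> sphere 0 s \<Longrightarrow> u y \<le> u z0"
    using continuous_attains_sup[OF compact_sphere ne continuous_on_subset[OF cont sphere_cball]] by blast
  have "u z0 < u 0" using z0(1) s by (intro strict) auto
  \<comment> \<open>On the small ball the perturbation varies by at most \<open>5 \<epsilon> s\<^sup>2\<close> between the origin, at distance
      \<open>2 s\<close> from \<open>w\<close>, and the sphere, at distance at most \<open>3 s\<close>.\<close>
  define \<epsilon> where "\<epsilon> = min (1 / (6 * s)) ((u 0 - u z0) / (6 * s\<^sup>2))"
  have \<epsilon>: "0 < \<epsilon>" "\<epsilon> * (6 * s) \<le> 1" "\<epsilon> * (6 * s\<^sup>2) \<le> u 0 - u z0"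
    using s(1) \<open>u z0 < u 0\<close> by (auto simp: \<epsilon>_def min_def pos_le_divide_eq[symmetric])
  obtain w :: "real^'n" where w: "norm w = 2 * s"
    using vector_choose_size[of "2 * s"] s(1) by auto
  have "continuous_on (cball 0 s) (\<lambda>y. u y - (- \<epsilon>) * (dist y w)\<^sup>2)"
    using cont by (intro continuous_intros)
  then obtain z where z: "z \<in> cball 0 s"
    and zmax: "\<And>y. y \<in> cball 0 s \<Longrightarrow> u y - (- \<epsilon>) * (dist y w)\<^sup>2 \<le> u z - (- \<epsilon>) * (dist z w)\<^sup>2"
    using continuous_attains_sup[OF compact_cball, of 0 s] s(1) by fastforce
  have d: "s \<le> dist z w" "dist z w \<le> 3 * s"
    using norm_triangle_ineq2[of w z] norm_triangle_ineq4[of z w] w z by (auto simp: dist_norm norm_minus_commute)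
  have "norm z \<noteq> s"
  proof
    assume "norm z = s"
    then have "u z \<le> u z0" by (intro z0(2)) simp
    moreover have "(dist z w)\<^sup>2 \<le> (3 * s)\<^sup>2" using d s(1) by (intro power_mono) auto
    then have "\<epsilon> * (dist z w)\<^sup>2 \<le> \<epsilon> * (9 * s\<^sup>2)"
      using \<epsilon>(1) by (intro mult_left_mono) (auto simp: power2_eq_square)
    moreover have "u 0 + \<epsilon> * (4 * s\<^sup>2) \<le> u z + \<epsilon> * (dist z w)\<^sup>2"
      using zmax[of 0] s(1) w by (simp add: power2_eq_square)
    moreover have "0 < \<epsilon> * s\<^sup>2" using \<epsilon>(1) s(1) by simp
    ultimately show False using \<epsilon>(3) by (simp add: algebra_simps)
  qed
  then have zs: "norm z < s" using z by simp
  have z1: "z \<in> ball 0 1" using z sub by blast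
  have zw: "z \<noteq> w" using d(1) s(1) by auto
  have small: "2 * \<bar>- \<epsilon>\<bar> * dist z w \<le> 1"
  proof -
    have "\<epsilon> * dist z w \<le> \<epsilon> * (3 * s)" using d(2) \<epsilon>(1) by (intro mult_left_mono) auto
    moreover have "\<epsilon> * (6 * s) = 2 * (\<epsilon> * (3 * s))" by simp
    moreover have "2 * \<bar>- \<epsilon>\<bar> * dist z w = 2 * (\<epsilon> * dist z w)" using \<epsilon>(1) by simp
    ultimately show ?thesis using \<epsilon>(2) by linarith
  qed
  have "f z * max (u z) 0 powr m
      \<le> (2 * \<bar>- \<epsilon>\<bar> * dist z w) powr \<theta> * (2 * (- \<epsilon>) * K + (b + q) * (2 * \<bar>- \<epsilon>\<bar> * dist z w))"
  proof (rule quadratic_test[OF z1 _ _ zw _ small])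
    show "s - norm z > 0" "- \<epsilon> \<noteq> 0" using zs \<epsilon>(1) by auto
    fix y assume "y \<in> ball 0 1 \<inter> ball z (s - norm z)"
    then have "dist z y < s - norm z" by simp
    then have "y \<in> cball 0 s" using norm_triangle_sub[of y z] by (simp add: dist_norm norm_minus_commute)
    then show "u y - (- \<epsilon>) * (dist y w)\<^sup>2 \<le> u z - (- \<epsilon>) * (dist z w)\<^sup>2" by (rule zmax)
  qed
  also have "\<dots> < 0"
  proof (rule mult_pos_neg)
    show "0 < (2 * \<bar>- \<epsilon>\<bar> * dist z w) powr \<theta>" using \<epsilon>(1) zw by simp
    have "(b + q) * dist z w \<le> (b + q) * (3 * s)"
      using d(2) b_nonneg q_nonneg by (intro mult_left_mono) auto
    then have "(b + q) * dist z w < K" using sK by (simp add: mult.commute)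
    then have "2 * \<epsilon> * ((b + q) * dist z w) < 2 * \<epsilon> * K" using \<epsilon>(1) by simp
    then show "2 * (- \<epsilon>) * K + (b + q) * (2 * \<bar>- \<epsilon>\<bar> * dist z w) < 0"
      using \<epsilon>(1) by (simp add: algebra_simps)
  qed
  finally show False using mult_nonneg_nonneg[OF f_nonneg[OF z1], of "max (u z) 0 powr m"] by simp
qed

lemma maximum_principle:
  assumes "r > 0" "cball a r \<subseteq> ball 0 1" "y \<in> cball a r"
  obtains z where "z \<in> sphere a r" "u y \<le> u z"
proof (rule ccontr)
  assume "\<not> thesis"
  with that have *: "u z < u y" if "z \<in> sphere a r" for z using \<open>z \<in> sphere a r\<close> by force
  have cont: "continuous_on (cball a r) u" using u_cont assms(2) by (rule continuous_on_subset)
  obtain z where z: "z \<in> cball a r" and zmax: "\<And>x. x \<in> cball a r \<Longrightarrow> u x \<le> u z"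
    using continuous_attains_sup[OF compact_cball _ cont] assms(1) by force
  have "sphere a r \<noteq> {}" using assms(1) by simp
  then obtain s where s: "s \<in> sphere a r" by blast
  have sb: "s \<in> ball 0 1" using s assms(2) by auto
  have pos: "0 < u z" using u_nonneg[OF sb] *[OF s] zmax[OF assms(3)] by linarith
  have interior: "x = 0 \<and> x \<in> ball a r" if x: "x \<in> cball a r" "u x = u z" for x
  proof -
    have xb: "x \<in> ball a r"
      using *[of x] zmax[OF assms(3)] x by (cases "dist a x = r") auto
    have "x = 0"
    proof (rule ccontr)
      assume "x \<noteq> 0"
      obtain e where e: "e > 0" "ball x e \<subseteq> ball a r" using openE[OF open_ball xb] by blast
      show False
      proof (rule no_local_max[OF _ \<open>x \<noteq> 0\<close> _ e(1)])
        show "x \<in> ball 0 1" "0 < u x" using x pos assms(2) by auto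
        fix y assume "y \<in> ball 0 1 \<inter> ball x e"
        then have "y \<in> cball a r" using e(2) ball_subset_cball by blast
        then show "u y \<le> u x" using zmax x(2) by simp
      qed
    qed
    then show ?thesis using xb by simp
  qed
  have z0: "z = 0" "0 \<in> ball a r" using interior[OF z refl] by auto
  obtain e where e: "e > 0" "cball 0 e \<subseteq> ball a r" using open_ball[of a r] z0(2) unfolding open_contains_cball by blast
  show False
  proof (rule no_strict_local_max[OF e(1)])
    show "cball (0 :: real^'n) e \<subseteq> ball 0 1"
      by (rule order_trans[OF e(2) order_trans[OF ball_subset_cball assms(2)]])
    fix y :: "real^'n" assume y: "y \<in> cball 0 e - {0}"
    then have "y \<in> cball a r" using e(2) ball_subset_cball by blast
    then show "u y < u 0" using zmax[of y] interior[of y] y z0(1) by force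
  qed
qed

section \<open>Growth where the right-hand side is positive\<close>

text \<open>The bound \<open>4 A r\<close> is the largest gradient norm of \<open>A |x - w|\<^sup>2\<close> for \<open>x\<close> and \<open>w\<close> in the
  ball. The level \<open>v\<close> lies strictly below \<open>u y\<close> so that \<open>u w > v\<close> still holds for \<open>w\<close> near \<open>y\<close>.\<close>

lemma growth:
  assumes "r > 0" "A > 0" "cball y r \<subseteq> ball 0 1" "0 \<notin> cball y r" "0 < v" "v < u y"
    and \<kappa>: "\<And>x. x \<in> cball y r \<Longrightarrow> \<kappa> \<le> f x" "0 \<le> \<kappa>"
    and small: "4 * A * r \<le> 1"
    and super: "(4 * A * r) powr \<theta> * (2 * A * K + (b + q) * (4 * A * r)) < \<kappa> * v powr m"
  obtains z where "z \<in> sphere y r" "u y + A * r\<^sup>2 \<le> u z"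
proof (rule ccontr)
  assume "\<not> thesis"
  with that have *: "u z < u y + A * r\<^sup>2" if "z \<in> sphere y r" for z using \<open>z \<in> sphere y r\<close> by force
  have cont: "continuous_on (cball y r) u" using u_cont assms(3) by (rule continuous_on_subset)
  have yb: "y \<in> ball 0 1" using subsetD[OF assms(3), of y] assms(1) by simp
  have ne: "sphere y r \<noteq> {}" using assms(1) by simp
  obtain z0 where z0: "z0 \<in> sphere y r" "\<And>z. z \<in> sphere y r \<Longrightarrow> u z \<le> u z0"
    using continuous_attains_sup[OF compact_sphere ne continuous_on_subset[OF cont sphere_cball]] by blast
  have "isCont u y" using u_cont yb by (simp add: continuous_on_eq_continuous_at)
  then have uy: "(u \<longlongrightarrow> u y) (nhds y)" by (simp add: isCont_def tendsto_at_iff_tendsto_nhds)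
  then have ev1: "\<forall>\<^sub>F w in nhds y. v < u w" using assms(6) by (rule order_tendstoD(1))
  have "((\<lambda>w. u w + A * (r - dist y w)\<^sup>2) \<longlongrightarrow> u y + A * (r - dist y y)\<^sup>2) (nhds y)"
    by (intro tendsto_intros uy) (simp add: filterlim_ident)
  then have ev2: "\<forall>\<^sub>F w in nhds y. u z0 < u w + A * (r - dist y w)\<^sup>2"
    using *[OF z0(1)] by (intro order_tendstoD) auto
  obtain d' where d': "d' > 0" "\<And>w. dist w y < d' \<Longrightarrow> v < u w \<and> u z0 < u w + A * (r - dist y w)\<^sup>2"
    using eventually_conj[OF ev1 ev2] unfolding eventually_nhds_metric by blast
  define d where "d = min d' r"
  have d: "d > 0" "d \<le> r" using d'(1) assms(1) by (auto simp: d_def)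
  \<comment> \<open>If \<open>w\<close> is close to \<open>y\<close>, then \<open>x \<mapsto> u x - A |x - w|\<^sup>2\<close> is largest at \<open>x = w\<close>.\<close>
  have bound: "u x \<le> u w + A * (dist x w)\<^sup>2" if w: "w \<in> ball y d" and x: "x \<in> cball y r" for w x
  proof -
    have w': "v < u w" "u z0 < u w + A * (r - dist y w)\<^sup>2" "dist y w < r"
      using d'(2)[of w] w by (auto simp: d_def dist_commute)
    have "continuous_on (cball y r) (\<lambda>x. u x - A * (dist x w)\<^sup>2)"
      using cont by (intro continuous_intros)
    then obtain z where z: "z \<in> cball y r"
      and zmax: "\<And>x. x \<in> cball y r \<Longrightarrow> u x - A * (dist x w)\<^sup>2 \<le> u z - A * (dist z w)\<^sup>2"
      using continuous_attains_sup[OF compact_cball, of y r] assms(1) by fastforce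
    have uz: "u w \<le> u z - A * (dist z w)\<^sup>2" using zmax[of w] w'(3) by simp
    have "dist y z \<noteq> r"
    proof
      assume r: "dist y z = r"
      then have "u z \<le> u z0" by (intro z0(2)) simp
      moreover have "(r - dist y w)\<^sup>2 \<le> (dist z w)\<^sup>2"
        using dist_triangle[of y z w] r w'(3) by (intro power_mono) (auto simp: dist_commute)
      then have "A * (r - dist y w)\<^sup>2 \<le> A * (dist z w)\<^sup>2" using assms(2) by simp
      ultimately show False using w'(2) uz by linarith
    qed
    then have zr: "dist y z < r" using z by simp
    have "z = w"
    proof (rule ccontr)
      assume zw: "z \<noteq> w"
      have zb: "z \<in> ball 0 1" using z assms(3) by auto
      have "dist z w \<le> 2 * r" using dist_triangle[of z w y] zr w'(3) by (simp add: dist_commute)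
      then have le: "2 * \<bar>A\<bar> * dist z w \<le> 4 * A * r"
        using mult_left_mono[of "dist z w" "2 * r" "2 * A"] assms(2) by simp
      have "f z * max (u z) 0 powr m
          \<le> (2 * \<bar>A\<bar> * dist z w) powr \<theta> * (2 * A * K + (b + q) * (2 * \<bar>A\<bar> * dist z w))"
      proof (rule quadratic_test[OF zb _ _ zw])
        show "r - dist y z > 0" "A \<noteq> 0" using zr assms(2) by auto
        show "2 * \<bar>A\<bar> * dist z w \<le> 1" using le small by linarith
        fix x assume "x \<in> ball 0 1 \<inter> ball z (r - dist y z)"
        then have "x \<in> cball y r" using dist_triangle[of y x z] by simp
        then show "u x - A * (dist x w)\<^sup>2 \<le> u z - A * (dist z w)\<^sup>2" by (rule zmax)
      qed
      also have "\<dots> \<le> (4 * A * r) powr \<theta> * (2 * A * K + (b + q) * (4 * A * r))"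
      proof (rule mult_mono)
        show "(2 * \<bar>A\<bar> * dist z w) powr \<theta> \<le> (4 * A * r) powr \<theta>"
          using le \<theta> by (intro powr_mono2) auto
        show "2 * A * K + (b + q) * (2 * \<bar>A\<bar> * dist z w) \<le> 2 * A * K + (b + q) * (4 * A * r)"
          using le b_nonneg q_nonneg by (intro add_left_mono mult_left_mono) auto
      qed (use K_pos assms(2) b_nonneg q_nonneg in auto)
      also have "\<dots> < \<kappa> * v powr m" by (rule super)
      also have "\<dots> \<le> f z * max (u z) 0 powr m"
      proof (intro mult_mono powr_mono2)
        have "0 \<le> A * (dist z w)\<^sup>2" using assms(2) by simp
        then show "v \<le> max (u z) 0" using uz w'(1) by linarith
      qed (use \<kappa> z m assms(5) f_nonneg[OF zb] in auto)
      finally show False by simp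
    qed
    then show ?thesis using zmax[OF x] by simp
  qed
  have const: "u x = u y" if "x \<in> ball y d" for x
  proof (rule constant_if_quadratic_upper_bound[of "ball y d" u A])
    show "u x \<le> u w + A * (dist x w)\<^sup>2" if "x \<in> ball y d" "w \<in> ball y d" for x w
      using bound[of w x] that d(2) by auto
  qed (use that d in auto)
  show False
  proof (rule no_local_max[OF yb])
    show "y \<noteq> 0" using assms(1,4) by auto
    show "0 < u y" "0 < d" using assms(5,6) d(1) by auto
  qed (use const in auto)
qed

section \<open>Doubling the radius\<close>

text \<open>The growth lemma is used at radius \<open>t/8\<close> with \<open>A = c D t\<^sup>\<beta>\<^sup>-\<^sup>2\<close>; the value of \<open>D\<close> makes
  \<open>A (t/8)\<^sup>2\<close> equal to the required gain \<open>c (2\<^sup>\<beta> - 1) t\<^sup>\<beta>\<close>. The relation defining \<open>\<beta>\<close> makes both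
  sides of the supersolution condition scale with the same power of \<open>t\<close>.\<close>

lemma doubling:
  assumes \<beta>: "\<beta> * (1 + \<theta> - m) = 2 + \<theta> + \<alpha>" "1 < \<beta>" and D: "D = 64 * (2 powr \<beta> - 1)"
    and c: "0 < c" "c * D \<le> 1" "(c * D) powr (1 + \<theta>) * (2 * K + b + q) < c0 / 8 powr \<alpha> * (c / 2) powr m"
    and t: "0 < t" "t \<le> 1" "cball a (2 * t) \<subseteq> ball 0 1"
    and y: "y \<in> cball a t" "c * t powr \<beta> \<le> u y"
  obtains z where "z \<in> cball a (2 * t)" "c * (2 * t) powr \<beta> \<le> u z"
proof -
  have D0: "0 < D" using \<beta>(2) by (simp add: D)
  \<comment> \<open>If \<open>y\<close> is too close to the origin, the maximum principle replaces it by a point at distance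
      \<open>3t/4\<close> from \<open>y\<close>.\<close>
  obtain y' where y': "dist a y' \<le> 7 / 4 * t" "t / 4 \<le> norm y'" "u y \<le> u y'"
  proof (cases "t / 4 \<le> norm y")
    case True
    then show ?thesis using that[of y] y(1) t(1) by auto
  next
    case False
    have "cball y (3 / 4 * t) \<subseteq> cball a (2 * t)"
    proof
      fix x assume "x \<in> cball y (3 / 4 * t)"
      then show "x \<in> cball a (2 * t)" using dist_triangle[of a x y] y(1) t(1) by simp
    qed
    then have sub: "cball y (3 / 4 * t) \<subseteq> ball 0 1" using t(3) by blast
    obtain y' where y': "y' \<in> sphere y (3 / 4 * t)" "u y \<le> u y'"
      using maximum_principle[OF _ sub, of y] t(1) by auto
    have "dist a y' \<le> 7 / 4 * t" "t / 4 \<le> norm y'"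
      using y'(1) dist_triangle[of a y' y] norm_triangle_ineq4[of y y'] y(1) False t(1)
      by (simp_all add: dist_norm)
    then show ?thesis using that y'(2) by blast
  qed
  define T where "T = t powr (\<beta> - 2)"
  define A where "A = c * D * T"
  have T0: "0 < T" using t(1) by (simp add: T_def)
  have A0: "0 < A" using c(1) D0 T0 by (simp add: A_def)
  have tT: "t * T = t powr (\<beta> - 1)"
    using powr_add[of t 1 "\<beta> - 2"] t(1) by (simp add: T_def)
  have ttT: "T * t\<^sup>2 = t powr \<beta>"
    using powr_add[of t "\<beta> - 2" 2] t(1) by (simp add: T_def powr_numeral)
  have tT1: "t * T \<le> 1" unfolding tT using t \<beta>(2) by (intro powr_le1) auto
  have expo: "(\<beta> - 1) * \<theta> + (\<beta> - 2) = \<alpha> + \<beta> * m" using \<beta>(1) by (simp add: algebra_simps)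
  have crit: "(t * T) powr \<theta> * T = t powr \<alpha> * (t powr \<beta>) powr m"
    unfolding tT unfolding T_def powr_powr powr_add[symmetric] expo ..
  have x_lower: "t / 8 \<le> norm x" if "x \<in> cball y' (t / 8)" for x
    using that y'(2) norm_triangle_sub[of y' x] by (simp add: dist_norm)
  have sub2: "cball y' (t / 8) \<subseteq> cball a (2 * t)"
  proof
    fix x assume "x \<in> cball y' (t / 8)"
    then show "x \<in> cball a (2 * t)" using dist_triangle[of a x y'] y'(1) t(1) by simp
  qed
  have sub1: "cball y' (t / 8) \<subseteq> ball 0 1" using sub2 t(3) by blast
  obtain z where z: "z \<in> sphere y' (t / 8)" "u y' + A * (t / 8)\<^sup>2 \<le> u z"
  proof (rule growth[of "t / 8" A y' "c / 2 * t powr \<beta>" "c0 * (t / 8) powr \<alpha>"])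
    show "0 < t / 8" "0 < A" "cball y' (t / 8) \<subseteq> ball 0 1" "0 < c / 2 * t powr \<beta>"
      using t(1) A0 sub1 c(1) by auto
    show "0 \<notin> cball y' (t / 8)" using x_lower[of 0] t(1) by auto
    have "c / 2 * t powr \<beta> < c * t powr \<beta>" using c(1) t(1) by simp
    then show "c / 2 * t powr \<beta> < u y'" using y(2) y'(3) by linarith
    show "c0 * (t / 8) powr \<alpha> \<le> f x" if x: "x \<in> cball y' (t / 8)" for x
    proof -
      have "c0 * (t / 8) powr \<alpha> \<le> c0 * norm x powr \<alpha>"
        using x_lower[OF x] t(1) c0 \<alpha> by (intro mult_left_mono powr_mono2) auto
      also have "\<dots> \<le> f x" using x sub1 by (intro f_lower) blast
      finally show ?thesis .
    qed
    show "0 \<le> c0 * (t / 8) powr \<alpha>" using c0 by simp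
    have eq: "4 * A * (t / 8) = c * D / 2 * (t * T)" by (simp add: A_def)
    have le: "4 * A * (t / 8) \<le> c * D * (t * T)"
      unfolding eq using c(1) D0 t(1) T0 by simp
    also have "\<dots> \<le> 1 * 1" using c D0 t(1) T0 tT1 by (intro mult_mono) auto
    finally show "4 * A * (t / 8) \<le> 1" by simp
    have le2: "4 * A * (t / 8) \<le> c * D * T"
      using A0 t(2) mult_left_mono[of t 2 A] unfolding A_def[symmetric] by simp
    have "(4 * A * (t / 8)) powr \<theta> * (2 * A * K + (b + q) * (4 * A * (t / 8)))
        \<le> (c * D * (t * T)) powr \<theta> * (2 * (c * D * T) * K + (b + q) * (c * D * T))"
    proof (rule mult_mono)
      show "(4 * A * (t / 8)) powr \<theta> \<le> (c * D * (t * T)) powr \<theta>"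
        using le A0 t(1) \<theta> by (intro powr_mono2) auto
      show "2 * A * K + (b + q) * (4 * A * (t / 8)) \<le> 2 * (c * D * T) * K + (b + q) * (c * D * T)"
        unfolding A_def[symmetric] using le2 b_nonneg q_nonneg
        by (intro add_left_mono mult_left_mono) (auto simp: A_def)
    qed (use A0 t(1) K_pos b_nonneg q_nonneg in auto)
    also have "\<dots> = ((c * D) powr \<theta> * (c * D)) * (2 * K + b + q) * ((t * T) powr \<theta> * T)"
      using c(1) D0 t(1) T0 by (simp add: powr_mult algebra_simps)
    also have "(c * D) powr \<theta> * (c * D) = (c * D) powr (1 + \<theta>)"
      using c(1) D0 by (simp add: powr_add)
    also have "(c * D) powr (1 + \<theta>) * (2 * K + b + q) * ((t * T) powr \<theta> * T)
        < c0 / 8 powr \<alpha> * (c / 2) powr m * ((t * T) powr \<theta> * T)"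
      using c(3) t(1) T0 by (intro mult_strict_right_mono) auto
    also have "\<dots> = c0 * (t / 8) powr \<alpha> * (c / 2 * t powr \<beta>) powr m"
      unfolding crit using c(1) t(1) by (simp add: powr_mult powr_divide)
    finally show "(4 * A * (t / 8)) powr \<theta> * (2 * A * K + (b + q) * (4 * A * (t / 8)))
        < c0 * (t / 8) powr \<alpha> * (c / 2 * t powr \<beta>) powr m" .
  qed
  have "A * (t / 8)\<^sup>2 = c * (2 powr \<beta> - 1) * (T * t\<^sup>2)"
    by (simp add: A_def D power2_eq_square)
  then have "c * (2 * t) powr \<beta> \<le> u z"
    using z(2) y(2) y'(3) t(1) unfolding ttT by (simp add: powr_mult algebra_simps)
  moreover have "z \<in> cball a (2 * t)" using z(1) sub2 by auto
  ultimately show thesis using that by blast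
qed

lemma nondegeneracy_at_positive_point:
  assumes \<beta>: "\<beta> * (1 + \<theta> - m) = 2 + \<theta> + \<alpha>" "1 < \<beta>" and D: "D = 64 * (2 powr \<beta> - 1)"
    and c: "0 < c" "c * D \<le> 1" "(c * D) powr (1 + \<theta>) * (2 * K + b + q) < c0 / 8 powr \<alpha> * (c / 2) powr m"
    and r: "0 < r" "r \<le> 1" "cball a r \<subseteq> ball 0 1" and "0 < u a"
  obtains z where "z \<in> cball a r" "c * r powr \<beta> \<le> u z"
proof -
  \<comment> \<open>The bound is trivial at some radius \<open>r / 2\<^sup>N\<close> and is then doubled \<open>N\<close> times.\<close>
  define t where "t k = r / 2 ^ k" for k :: nat
  have t: "0 < t k" "t k \<le> r" for k
    using r(1) by (auto simp: t_def divide_le_eq)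
  have "(\<lambda>k. r * (1 / 2) ^ k) \<longlonglongrightarrow> r * 0" by (intro tendsto_intros LIMSEQ_realpow_zero) auto
  then have "t \<longlonglongrightarrow> 0" unfolding t_def[abs_def] by (simp add: power_divide)
  then have "(\<lambda>k. c * t k powr \<beta>) \<longlonglongrightarrow> c * 0 powr \<beta>"
    using \<beta>(2) t by (intro tendsto_intros tendsto_powr') (auto intro!: always_eventually less_imp_le)
  then have "\<forall>\<^sub>F k in sequentially. c * t k powr \<beta> < u a"
    using assms(10) by (intro order_tendstoD) auto
  then obtain N where N: "c * t N powr \<beta> < u a"
    by (auto simp: eventually_sequentially)
  have "\<exists>z\<in>cball a (t k). c * t k powr \<beta> \<le> u z" if "k \<le> N" for k
    using that
  proof (induction k rule: inc_induct)
    case base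
    show ?case using N t[of N] by (intro bexI[of _ a]) auto
  next
    case (step k)
    have eq: "t k = 2 * t (Suc k)" by (simp add: t_def)
    from step.IH obtain y where y: "y \<in> cball a (t (Suc k))" "c * t (Suc k) powr \<beta> \<le> u y" by blast
    have "cball a (2 * t (Suc k)) \<subseteq> ball 0 1"
      using t(2)[of k] r(3) unfolding eq by (meson cball_subset_cball_iff order_trans subset_cball)
    then obtain z where "z \<in> cball a (2 * t (Suc k))" "c * (2 * t (Suc k)) powr \<beta> \<le> u z"
      using doubling[OF \<beta> D c _ _ _ y] t[of "Suc k"] r(2) by (metis order_trans)
    then show ?case unfolding eq by blast
  qed
  from this[of 0] show thesis using that by (auto simp: t_def)
qed

end

section \<open>Nondegeneracy\<close>

lemma exists_small_constant:
  fixes \<theta> m :: real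
  assumes "0 < D" "0 < E" "0 < G" "m < 1 + \<theta>"
  obtains c where "0 < c" "c * D \<le> 1" "(c * D) powr (1 + \<theta>) * E < G * (c / 2) powr m"
proof -
  define M where "M = G / (2 powr m * (D powr (1 + \<theta>) * E))"
  have M: "0 < M" using assms by (simp add: M_def)
  define c where "c = min (1 / D) ((M / 2) powr (1 / (1 + \<theta> - m)))"
  have c: "0 < c" "c * D \<le> 1" using assms M by (auto simp: c_def min_def pos_le_divide_eq[symmetric])
  have "c powr (1 + \<theta> - m) \<le> ((M / 2) powr (1 / (1 + \<theta> - m))) powr (1 + \<theta> - m)"
    using c assms(4) by (intro powr_mono2) (auto simp: c_def)
  also have "\<dots> < M" using M assms(4) by (simp add: powr_powr)
  finally have *: "c powr (1 + \<theta> - m) < M" .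
  have "(c * D) powr (1 + \<theta>) * E = c powr (1 + \<theta> - m) * (c powr m * (D powr (1 + \<theta>) * E))"
    using c(1) assms(1) by (simp add: powr_mult powr_add powr_diff)
  also have "\<dots> < M * (c powr m * (D powr (1 + \<theta>) * E))"
    using * c(1) assms by (intro mult_strict_right_mono) auto
  also have "\<dots> = G * (c / 2) powr m"
    using assms c(1) by (simp add: M_def powr_divide)
  finally show thesis using that c by blast
qed

theorem theorem1p14:
  fixes p \<theta> \<sigma> m \<alpha> c0 normB norm\<rho> :: real
  assumes "1 < p" and "0 < \<theta>" and "1 + \<theta> < \<sigma>"
    and "0 \<le> m" and "m < 1 + \<theta>" and "0 < \<alpha>" and "0 < c0"
  shows "\<exists>C_ND>0. \<forall>(B :: real^'n \<Rightarrow> real^'n) (\<rho> :: real^'n \<Rightarrow> real)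
            (F :: (real^'n) set) (f :: real^'n \<Rightarrow> real) (u :: real^'n \<Rightarrow> real) (x0 :: real^'n).
      continuous_on (cball 0 1) B \<and> Linf_norm (ball 0 1) B = ereal normB \<and>
      continuous_on (cball 0 1) \<rho> \<and> Linf_norm (ball 0 1) \<rho> = ereal norm\<rho> \<and>
      closed F \<and> compactly_contained F (ball 0 1) \<and>
      continuous_on (ball 0 1) f \<and> (\<forall>x\<in>ball 0 1. 0 \<le> f x) \<and>
      (\<exists>c1 c2. 0 < c1 \<and> c1 \<le> c2 \<and>
         (\<forall>x\<in>ball 0 1. c1 * infdist x F powr \<alpha> \<le> f x \<and> f x \<le> c2 * infdist x F powr \<alpha>)) \<and>
      continuous_on (ball 0 1) u \<and> (\<forall>x\<in>ball 0 1. 0 \<le> u x) \<and>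
      viscosity_solution p \<theta> (H_term \<theta> \<sigma> B \<rho>) (f0_term m f) (ball 0 1) u \<and>
      x0 \<in> closure {x \<in> ball 0 1. 0 < u x} \<inter> ball 0 (1/2) \<and>
      (\<forall>x\<in>ball 0 1. c0 * norm x powr \<alpha> \<le> f x)
      \<longrightarrow> (\<forall>r. 0 < r \<and> r < 1/2 \<longrightarrow>
             (SUP x\<in>sphere x0 r. u x) \<ge> C_ND * r powr ((2 + \<theta> + \<alpha>) / (1 + \<theta> - m)))"
proof -
  \<comment> \<open>The absolute values keep the conditions on \<open>c\<close> satisfiable when \<open>normB\<close> or \<open>norm\<rho>\<close> is
      negative, in which case the hypotheses are contradictory.\<close>
  define \<beta> where "\<beta> = (2 + \<theta> + \<alpha>) / (1 + \<theta> - m)"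
  define K where "K = real CARD('n) + p - 2"
  define D where "D = 64 * (2 powr \<beta> - 1)"
  have \<beta>: "\<beta> * (1 + \<theta> - m) = 2 + \<theta> + \<alpha>" "1 < \<beta>"
    using assms by (auto simp: \<beta>_def less_divide_eq)
  have "real CARD('n) \<ge> 1" by (simp add: Suc_leI)
  then have "0 < K" using assms(1) unfolding K_def by linarith
  then have E: "0 < 2 * K + \<bar>normB\<bar> + \<bar>norm\<rho>\<bar>" by linarith
  have "0 < D" using \<beta>(2) by (simp add: D_def)
  then obtain c where c: "0 < c" "c * D \<le> 1"
      "(c * D) powr (1 + \<theta>) * (2 * K + \<bar>normB\<bar> + \<bar>norm\<rho>\<bar>) < c0 / 8 powr \<alpha> * (c / 2) powr m"
    using exists_small_constant[OF _ E, of D "c0 / 8 powr \<alpha>" m \<theta>] assms(5,7) by auto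
  show ?thesis
    unfolding \<beta>_def[symmetric]
  proof (intro exI[of _ "c / 2 powr \<beta>"] conjI allI impI; (elim conjE)?)
    show "0 < c / 2 powr \<beta>" using c(1) by simp
  next
    fix B :: "real^'n \<Rightarrow> real^'n" and \<rho> f u :: "real^'n \<Rightarrow> real" and x0 :: "real^'n" and r :: real
    assume B: "continuous_on (cball 0 1) B" "Linf_norm (ball 0 1) B = ereal normB"
      and \<rho>: "continuous_on (cball 0 1) \<rho>" "Linf_norm (ball 0 1) \<rho> = ereal norm\<rho>"
      and u: "\<forall>x\<in>ball 0 1. 0 \<le> u x"
        "viscosity_solution p \<theta> (H_term \<theta> \<sigma> B \<rho>) (f0_term m f) (ball 0 1) u"
      and x0: "x0 \<in> closure {x \<in> ball 0 1. 0 < u x} \<inter> ball 0 (1/2)"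
      and f: "\<forall>x\<in>ball 0 1. c0 * norm x powr \<alpha> \<le> f x"
      and r: "0 < r" "r < 1/2"
    have "norm (B x) \<le> \<bar>normB\<bar>" if "x \<in> ball 0 1" for x
      using continuous_Linf_norm_bound[OF open_ball continuous_on_subset[OF B(1) ball_subset_cball] B(2) that]
      by linarith
    moreover have "\<bar>\<rho> x\<bar> \<le> \<bar>norm\<rho>\<bar>" if "x \<in> ball 0 1" for x
      using continuous_Linf_norm_bound[OF open_ball continuous_on_subset[OF \<rho>(1) ball_subset_cball] \<rho>(2) that]
      by simp
    ultimately interpret nonnegative_subsolution p \<theta> \<sigma> m \<alpha> c0 "\<bar>normB\<bar>" "\<bar>norm\<rho>\<bar>" K B \<rho> f u
      using assms u f by unfold_locales (auto simp: K_def viscosity_solution_def)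
    have sub: "cball x0 r \<subseteq> ball 0 1"
    proof
      fix x assume "x \<in> cball x0 r"
      then show "x \<in> ball 0 1"
        using x0 r(2) norm_triangle_sub[of x x0] by (simp add: dist_norm norm_minus_commute)
    qed
    obtain a where a: "a \<in> {x \<in> ball 0 1. 0 < u x}" "dist a x0 < r / 2"
      using closure_approachable[THEN iffD1, OF IntD1[OF x0], rule_format, of "r / 2"] r(1) by auto
    have sub': "cball a (r / 2) \<subseteq> cball x0 r"
    proof
      fix x assume "x \<in> cball a (r / 2)"
      then show "x \<in> cball x0 r" using a(2) dist_triangle[of x0 x a] by (simp add: dist_commute)
    qed
    obtain y where y: "y \<in> cball a (r / 2)" "c * (r / 2) powr \<beta> \<le> u y"
      using nondegeneracy_at_positive_point[OF \<beta> D_def c, of "r / 2" a] r a sub sub' by auto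
    obtain z where z: "z \<in> sphere x0 r" "u y \<le> u z"
      using maximum_principle[OF r(1) sub, of y] y(1) sub' by blast
    have "continuous_on (sphere x0 r) u"
      by (rule continuous_on_subset[OF u_cont order_trans[OF sphere_cball sub]])
    then have "bdd_above (u ` sphere x0 r)"
      by (intro bounded_imp_bdd_above compact_imp_bounded compact_continuous_image compact_sphere)
    then have "u z \<le> (SUP x\<in>sphere x0 r. u x)" using z(1) by (rule cSUP_upper[rotated])
    then show "c / 2 powr \<beta> * r powr \<beta> \<le> (SUP x\<in>sphere x0 r. u x)"
      using y(2) z(2) r(1) by (simp add: powr_divide)
  qed
qed

end
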